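(* Let $(I,<)$ be a linearly ordered set and let $\langle\mathcal{U}_i\mid i\in I\rangle$ be a family of ultrafilters on $\mathbb{N}$ such that $\mathcal{U}_i\leq_{fe}\mathcal{U}_j$ whenever $i<j$ in $I$. Then there exists an ultrafilter $\mathcal{U}$ on $\mathbb{N}$ such that $\mathcal{U}_i\leq_{fe}\mathcal{U}$ for every $i\in I$.
   Context: $\mathbb{N}=\{0,1,2,\dots\}$. For $A,B\subseteq\mathbb{N}$, $A\leq_{fe}B$ means that for every finite $F\subseteq A$ there is $k\in\mathbb{N}$ with $F+k\subseteq B$. For ultrafilters $\mathcal{U},\mathcal{V}$ on $\mathbb{N}$, $\mathcal{U}\leq_{fe}\mathcal{V}$ means that for every $B\in\mathcal{V}$ there is $A\in\mathcal{U}$ with $A\leq_{fe}B$. *)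

theory Defs
  imports Main
begin

text \<open>
  A set \<open>A\<close> belongs to a filter \<open>F\<close> iff \<open>\<forall>\<^sub>F x in F. x \<in> A\<close>.
  An ultrafilter need not be free: principal ultrafilters are included.
\<close>

definition ultrafilter :: "'a filter \<Rightarrow> bool" where
  "ultrafilter F \<longleftrightarrow>
     F \<noteq> bot \<and> (\<forall>A. (\<forall>\<^sub>F x in F. x \<in> A) \<or> (\<forall>\<^sub>F x in F. x \<in> - A))"

definition fe_set :: "nat set \<Rightarrow> nat set \<Rightarrow> bool" where
  "fe_set A B \<longleftrightarrow> (\<forall>F. finite F \<and> F \<subseteq> A \<longrightarrow> (\<exists>k. (\<lambda>n. n + k) ` F \<subseteq> B))"

definition fe_filter :: "nat filter \<Rightarrow> nat filter \<Rightarrow> bool" where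
  "fe_filter U V \<longleftrightarrow>
     (\<forall>B. (\<forall>\<^sub>F n in V. n \<in> B) \<longrightarrow> (\<exists>A. (\<forall>\<^sub>F n in U. n \<in> A) \<and> fe_set A B))"

end

theory Submission
  imports Defs
begin

text \<open>
  The limit superior of the family along \<open>I\<close> is a proper filter \<open>F\<close>, and any ultrafilter \<open>V \<le> F\<close>
  is an upper bound: if \<open>B \<in> V\<close> and \<open>i \<in> I\<close>, then \<open>B \<in> U j\<close> for some \<open>j \<ge> i\<close>, since otherwise
  \<open>- B\<close> would belong to every \<open>U j\<close> with \<open>j \<ge> i\<close>, hence to \<open>F\<close> and to \<open>V\<close>.
\<close>

text \<open>A smaller filter contains more sets, so Zorn's lemma is applied to the reversed order
  \<open>\<ge>\<close>: a minimal proper filter below \<open>F\<close> decides every set.\<close>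

lemma ultrafilter_below:
  fixes F :: "'a filter"
  assumes "F \<noteq> bot"
  shows "\<exists>V. ultrafilter V \<and> V \<le> F"
proof -
  define A where "A = {G :: 'a filter. G \<noteq> bot \<and> G \<le> F}"
  have "\<exists>m\<in>A. \<forall>a\<in>A. m \<ge> a \<longrightarrow> a = m"
  proof (rule predicate_Zorn)
    show "partial_order_on A (relation_of (\<ge>) A)"
      by (rule partial_order_on_relation_ofI) auto
  next
    fix C :: "'a filter set"
    assume C: "C \<in> Chains (relation_of (\<ge>) A)"
    then have CA: "C \<subseteq> A" and chain: "\<And>x y. x \<in> C \<Longrightarrow> y \<in> C \<Longrightarrow> x \<le> y \<or> y \<le> x"
      by (auto simp: Chains_def relation_of_def)
    show "\<exists>u\<in>A. \<forall>a\<in>C. a \<ge> u"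
    proof (cases "C = {}")
      case True
      with assms show ?thesis by (auto simp: A_def)
    next
      case False
      \<comment> \<open>As \<open>C\<close> is a nonempty chain, every set in \<open>Inf C\<close>
        already lies in some member of \<open>C\<close>, and no member contains the empty
        set.\<close>
      have "Inf C \<noteq> bot"
        unfolding trivial_limit_def
      proof
        assume "eventually (\<lambda>x. False) (Inf C)"
        then obtain b where "b \<in> C" "eventually (\<lambda>x. False) b"
          using eventually_Inf_base[OF False] chain by (metis inf_absorb1 inf_absorb2 order_refl)
        with CA show False by (auto simp: A_def trivial_limit_def)
      qed
      moreover have "Inf C \<le> F"
        using False CA by (auto simp: A_def intro: Inf_lower2)
      ultimately show ?thesis by (auto simp: A_def intro: Inf_lower)
    qed
  qed
  then obtain V where V: "V \<noteq> bot" "V \<le> F"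
    and min: "\<And>G. G \<noteq> bot \<Longrightarrow> G \<le> V \<Longrightarrow> G = V"
    unfolding A_def by (auto intro: order_trans)
  have "(\<forall>\<^sub>F x in V. x \<in> S) \<or> (\<forall>\<^sub>F x in V. x \<in> - S)" for S
  \<comment> \<open>This infimum is the filter generated by \<open>V\<close> and \<open>S\<close>.
    If it is improper, \<open>- S\<close> is in \<open>V\<close>; otherwise minimality makes it
    equal to \<open>V\<close>, so \<open>S\<close> is in \<open>V\<close>.\<close>
  proof (cases "inf V (principal S) = bot")
    case True
    then show ?thesis
      by (simp add: trivial_limit_def eventually_inf_principal)
  next
    case False
    then have "inf V (principal S) = V" by (rule min) simp
    then show ?thesis by (metis inf.cobounded2 le_principal)
  qed
  with V show ?thesis by (auto simp: ultrafilter_def)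
qed

lemma fe_filter_refl: "fe_filter U U"
proof -
  have "fe_set A A" for A
    unfolding fe_set_def by (intro allI impI exI[of _ 0]) auto
  then show ?thesis by (auto simp: fe_filter_def)
qed

theorem theorem23:
  fixes I :: "'i set" and r :: "'i rel" and U :: "'i \<Rightarrow> nat filter"
  assumes "strict_linear_order_on I r"
    and "\<And>i. i \<in> I \<Longrightarrow> ultrafilter (U i)"
    and "\<And>i j. i \<in> I \<Longrightarrow> j \<in> I \<Longrightarrow> (i, j) \<in> r \<Longrightarrow> fe_filter (U i) (U j)"
  shows "\<exists>V :: nat filter. ultrafilter V \<and> (\<forall>i\<in>I. fe_filter (U i) V)"
proof -
  \<comment> \<open>Including \<open>i\<close> itself keeps \<open>up i\<close> nonempty when
    \<open>i\<close> is the last element of \<open>I\<close>, so that \<open>T i\<close> is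
    proper.\<close>
  define up where "up i = {j \<in> I. j = i \<or> (i, j) \<in> r}" for i
  define T where "T i = Sup (U ` up i)" for i
  define F where "F = Inf (T ` I)"
  have "F \<noteq> bot"
  proof (cases "I = {}")
    case True
    then show ?thesis by (simp add: F_def trivial_limit_def eventually_top)
  next
    case False
    \<comment> \<open>By totality the sets \<open>up i\<close> are nested, so the larger of
      \<open>i\<close> and \<open>j\<close> serves as \<open>k\<close>. Directedness then puts every
      set of \<open>F\<close> into some \<open>T i\<close>, hence into \<open>U i\<close>.\<close>
    have dir: "\<exists>k\<in>I. T k \<le> inf (T i) (T j)" if "i \<in> I" "j \<in> I" for i j
    proof -
      have "\<exists>k\<in>I. up k \<subseteq> up i \<and> up k \<subseteq> up j"
        using assms(1) that unfolding strict_linear_order_on_def total_on_def up_def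
        by (cases "i = j"; cases "(i, j) \<in> r") (auto dest: transD)
      then show ?thesis
        unfolding T_def by (meson Sup_subset_mono image_mono le_inf_iff)
    qed
    show ?thesis
      unfolding trivial_limit_def
    proof
      assume "eventually (\<lambda>x. False) F"
      then obtain i where i: "i \<in> I" "eventually (\<lambda>x. False) (T i)"
        unfolding F_def by (subst (asm) eventually_INF_base) (use False dir in auto)
      then have "eventually (\<lambda>x. False) (U i)"
        by (auto simp: T_def eventually_Sup up_def)
      with assms(2)[OF i(1)] show False by (simp add: ultrafilter_def trivial_limit_def)
    qed
  qed
  then obtain V where V: "ultrafilter V" "V \<le> F" using ultrafilter_below by blast
  have "fe_filter (U i) V" if i: "i \<in> I" for i
    unfolding fe_filter_def
  proof (intro allI impI)
    fix B assume B: "\<forall>\<^sub>F n in V. n \<in> B"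
    have "\<exists>j\<in>up i. \<forall>\<^sub>F n in U j. n \<in> B"
    proof (rule ccontr)
      assume "\<not> ?thesis"
      then have "\<forall>j\<in>up i. \<forall>\<^sub>F n in U j. n \<in> - B"
        using assms(2) by (auto simp: up_def ultrafilter_def)
      then have "\<forall>\<^sub>F n in T i. n \<in> - B" by (simp add: T_def eventually_Sup)
      moreover have "V \<le> T i" using V(2) i by (auto simp: F_def le_Inf_iff)
      ultimately have "\<forall>\<^sub>F n in V. n \<in> - B" by (rule filter_leD[rotated])
      with B have "\<forall>\<^sub>F n in V. False" by eventually_elim simp
      with V(1) show False by (simp add: ultrafilter_def trivial_limit_def)
    qed
    then obtain j where j: "j \<in> up i" "\<forall>\<^sub>F n in U j. n \<in> B" by blast
    \<comment> \<open>The hypothesis covers \<open>(i, j) \<in> r\<close>; the case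
      \<open>j = i\<close> is reflexivity, by the shift 0.\<close>
    have "fe_filter (U i) (U j)"
      using j(1) i assms(3) fe_filter_refl by (auto simp: up_def)
    with j(2) show "\<exists>A. (\<forall>\<^sub>F n in U i. n \<in> A) \<and> fe_set A B" by (simp add: fe_filter_def)
  qed
  with V(1) show ?thesis by blast
qed

end
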